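(* Let $\mathrm{DS} = \{\langle e,x,u\rangle : (\forall y)[L^e_x \neq L^e_y \rightarrow L^e_x \cap D_u \neq L^e_y \cap D_u]\}$ and let $\mathrm{MDS} = \{\langle e,x,u\rangle \in \mathrm{DS} : (\forall u')[\,|D_{u'}| < |D_u| \rightarrow \langle e,x,u'\rangle \notin \mathrm{DS}]\}$. Then $\mathrm{MDS}$ is $\Pi^0_3$-complete.
   Context: $W_0,W_1,\ldots$ is an acceptable numbering of all r.e. subsets of $\mathbb N$, and $\langle\cdot,\cdot\rangle$ (and its iterates for tuples) is a standard recursive pairing function. For all $e,j$, $L^e_j = \{x : \langle j,x\rangle \in W_e\}$ and $\mathcal L_e = \{L^e_j : j\in\mathbb N\}$. $D_0,D_1,\ldots$ is the canonical numbering of finite sets: $D_0=\emptyset$ and $D_{2^{x_1}+\cdots+2^{x_n}} = \{x_1,\ldots,x_n\}$ for pairwise distinct $x_i$. $\Pi^0_n$-complete means definable by a $\Pi^0_n$ formula and every $\Pi^0_n$ set many-one reduces to it via a recursive function. *)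

theory Defs
  imports Main "HOL-Library.Nat_Bijection"
begin

text \<open>
  Total recursive functions of arity \<open>n\<close>, as the least class containing the initial functions and
  closed under composition, primitive recursion and minimisation of regular functions. An \<open>n\<close>-ary
  function is represented on argument lists of length \<open>n\<close>; rule \<open>cong\<close> makes its values on lists of
  other lengths irrelevant.
\<close>

inductive recursive :: "nat \<Rightarrow> (nat list \<Rightarrow> nat) \<Rightarrow> bool" where
  zero: "recursive n (\<lambda>xs. 0)"
| succ: "recursive 1 (\<lambda>xs. Suc (xs ! 0))"
| proj: "i < n \<Longrightarrow> recursive n (\<lambda>xs. xs ! i)"
| comp: "recursive (length gs) f \<Longrightarrow> (\<And>g. g \<in> set gs \<Longrightarrow> recursive n g) \<Longrightarrow>
    recursive n (\<lambda>xs. f (map (\<lambda>g. g xs) gs))"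
| prec: "recursive n f \<Longrightarrow> recursive (Suc (Suc n)) g \<Longrightarrow>
    recursive (Suc n) (\<lambda>xs. rec_nat (f (tl xs)) (\<lambda>y r. g (y # r # tl xs)) (hd xs))"
| mu: "recursive (Suc n) f \<Longrightarrow> (\<And>xs. length xs = n \<Longrightarrow> \<exists>y. f (y # xs) = 0) \<Longrightarrow>
    recursive n (\<lambda>xs. LEAST y. f (y # xs) = 0)"
| cong: "recursive n f \<Longrightarrow> (\<And>xs. length xs = n \<Longrightarrow> f xs = g xs) \<Longrightarrow> recursive n g"

definition recursive_fun :: "(nat \<Rightarrow> nat) \<Rightarrow> bool" where
  "recursive_fun f \<longleftrightarrow> recursive 1 (\<lambda>xs. f (xs ! 0))"

definition recursive_rel :: "nat \<Rightarrow> (nat list \<Rightarrow> bool) \<Rightarrow> bool" where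
  "recursive_rel n R \<longleftrightarrow> recursive n (\<lambda>xs. if R xs then 1 else 0)"

definition re :: "nat set \<Rightarrow> bool" where
  "re A \<longleftrightarrow> A = {} \<or> (\<exists>f. recursive_fun f \<and> A = range f)"

definition uniformly_re :: "(nat \<Rightarrow> nat set) \<Rightarrow> bool" where
  "uniformly_re V \<longleftrightarrow> re {prod_encode (e, x) | e x. x \<in> V e}"

text \<open>
  A numbering of all r.e. sets is acceptable if it is uniformly r.e. and every uniformly r.e.
  numbering translates into it by a recursive function on indices.
\<close>

definition acceptable_numbering :: "(nat \<Rightarrow> nat set) \<Rightarrow> bool" where
  "acceptable_numbering W \<longleftrightarrow>
     range W = {A. re A} \<and> uniformly_re W \<and>
     (\<forall>V. uniformly_re V \<longrightarrow> (\<exists>f. recursive_fun f \<and> (\<forall>e. V e = W (f e))))"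

text \<open>
  The arithmetical hierarchy: \<open>n\<close> alternating unbounded number quantifiers in front of a
  recursive matrix, the outermost being existential for \<open>sigma_formula\<close> and universal for
  \<open>pi_formula\<close>. The list holds the values of the variables bound so far.
\<close>

fun sigma_formula :: "nat \<Rightarrow> (nat list \<Rightarrow> bool) \<Rightarrow> nat list \<Rightarrow> bool"
  and pi_formula :: "nat \<Rightarrow> (nat list \<Rightarrow> bool) \<Rightarrow> nat list \<Rightarrow> bool" where
  "sigma_formula 0 R xs \<longleftrightarrow> R xs"
| "sigma_formula (Suc n) R xs \<longleftrightarrow> (\<exists>y. pi_formula n R (xs @ [y]))"
| "pi_formula 0 R xs \<longleftrightarrow> R xs"
| "pi_formula (Suc n) R xs \<longleftrightarrow> (\<forall>y. sigma_formula n R (xs @ [y]))"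

definition pi_set :: "nat \<Rightarrow> nat set \<Rightarrow> bool" where
  "pi_set n A \<longleftrightarrow> (\<exists>R. recursive_rel (Suc n) R \<and> A = {x. pi_formula n R [x]})"

definition many_one_reducible :: "nat set \<Rightarrow> nat set \<Rightarrow> bool" where
  "many_one_reducible A B \<longleftrightarrow> (\<exists>f. recursive_fun f \<and> (\<forall>x. x \<in> A \<longleftrightarrow> f x \<in> B))"

definition pi_complete :: "nat \<Rightarrow> nat set \<Rightarrow> bool" where
  "pi_complete n A \<longleftrightarrow> pi_set n A \<and> (\<forall>B. pi_set n B \<longrightarrow> many_one_reducible B A)"

definition triple :: "nat \<Rightarrow> nat \<Rightarrow> nat \<Rightarrow> nat" where
  "triple e x u = prod_encode (e, prod_encode (x, u))"

abbreviation D :: "nat \<Rightarrow> nat set" where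
  "D \<equiv> set_decode"

lemma D_canonical: "finite F \<Longrightarrow> D (\<Sum>x\<in>F. 2 ^ x) = F"
  using set_encode_inverse[of F] by (simp add: set_encode_def)

definition L :: "(nat \<Rightarrow> nat set) \<Rightarrow> nat \<Rightarrow> nat \<Rightarrow> nat set" where
  "L W e j = {x. prod_encode (j, x) \<in> W e}"

definition DS :: "(nat \<Rightarrow> nat set) \<Rightarrow> nat set" where
  "DS W = {triple e x u | e x u.
     \<forall>y. L W e x \<noteq> L W e y \<longrightarrow> L W e x \<inter> D u \<noteq> L W e y \<inter> D u}"

definition MDS :: "(nat \<Rightarrow> nat set) \<Rightarrow> nat set" where
  "MDS W = {triple e x u | e x u.
     triple e x u \<in> DS W \<and>
     (\<forall>u'. card (D u') < card (D u) \<longrightarrow> triple e x u' \<notin> DS W)}"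

end

theory Submission imports Defs begin

text \<open>
  Upper bound: approximating \<open>L W e j\<close> by finite stages gives
  \<open>triple e x u \<in> DS W \<longleftrightarrow> (\<forall>y s. \<exists>t\<ge>s. P)\<close> with decidable \<open>P\<close>, and comparing cardinalities
  of canonical finite sets is decidable, so minimality is a universal quantifier in front of a
  \<open>\<Sigma>\<^sup>0\<^sub>2\<close> condition.

  Hardness: for \<open>B = {p. \<forall>v. \<exists>b. \<forall>c. R [p, v, b, c]}\<close>, attach to \<open>p\<close> a family containing the
  empty set, the complements of \<open>{0}\<close> and \<open>{1}\<close>, and for all \<open>v\<close> and \<open>b\<close> the set of all numbers
  from which \<open>v + 2\<close> is missing iff \<open>\<forall>c. R [p, v, b, c]\<close>. Then \<open>{0, 1}\<close> separates the empty set
  from the rest, \<open>{}\<close>, \<open>{0}\<close> and \<open>{1}\<close> do not, and \<open>{v + 2}\<close> fails to do so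
  iff \<open>\<exists>b. \<forall>c. R [p, v, b, c]\<close>; so \<open>{0, 1}\<close> is of minimal size iff \<open>p \<in> B\<close>.
\<close>

section \<open>Closure properties of recursive functions and relations\<close>

text \<open>Rule \<open>comp\<close> produces one fixed shape of term; here the target
  \<open>k\<close> need only agree with it on lists of length \<open>n\<close>.\<close>

lemma recursive_comp_list:
  assumes "recursive (length gs) f" "\<forall>g\<in>set gs. recursive n g"
    and "\<And>xs. length xs = n \<Longrightarrow> f (map (\<lambda>g. g xs) gs) = k xs"
  shows "recursive n k"
  by (rule recursive.cong[OF recursive.comp[OF assms(1)]]) (use assms in auto)

lemma recursive_comp1:
  assumes "recursive 1 (\<lambda>xs. F (xs ! 0))" "recursive n a"
  shows "recursive n (\<lambda>xs. F (a xs))"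
  by (rule recursive_comp_list[of "[a]" "\<lambda>xs. F (xs ! 0)"]) (use assms in auto)

lemma recursive_comp2:
  assumes "recursive 2 (\<lambda>xs. F (xs ! 0) (xs ! 1))" "recursive n a" "recursive n b"
  shows "recursive n (\<lambda>xs. F (a xs) (b xs))"
  by (rule recursive_comp_list[of "[a, b]" "\<lambda>xs. F (xs ! 0) (xs ! 1)"])
    (use assms in \<open>auto simp: numeral_2_eq_2\<close>)

text \<open>The projections rebuild the whole argument list behind a computed head. As
  \<open>prec\<close> recurses on the head, this allows recursion up to any recursive bound.\<close>

lemma recursive_subst_hd:
  assumes "recursive (Suc n) f" "recursive n b"
  shows "recursive n (\<lambda>xs. f (b xs # xs))"
proof (rule recursive_comp_list[of "b # map (\<lambda>i xs. xs ! i) [0..<n]" f])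
  fix xs :: "nat list" assume "length xs = n"
  then have "map ((\<lambda>g. g xs) \<circ> (\<lambda>i xs. xs ! i)) [0..<n] = xs"
    using map_nth[of xs] by (simp add: comp_def)
  then show "f (map (\<lambda>g. g xs) (b # map (\<lambda>i xs. xs ! i) [0..<n])) = f (b xs # xs)" by simp
qed (use assms in \<open>auto intro: recursive.proj\<close>)

lemma recursive_const: "recursive n (\<lambda>xs. c)"
proof (induction c)
  case (Suc c)
  show ?case
    by (rule recursive_comp1[of Suc, OF recursive.succ Suc])
qed (rule recursive.zero)

lemma recursive_Suc: "recursive n a \<Longrightarrow> recursive n (\<lambda>xs. Suc (a xs))"
  by (rule recursive_comp1[of Suc, OF recursive.succ])

text \<open>Under a binder the environment is extended at the front, so that variables appear
  as \<^term>\<open>hd\<close> and \<^term>\<open>nth\<close> of iterated tails.\<close>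

lemma recursive_hd: "0 < n \<Longrightarrow> recursive n (\<lambda>xs. hd xs)"
  by (rule recursive.cong[OF recursive.proj[of 0]]) (auto simp: hd_conv_nth)

lemma recursive_hd_tl: "Suc 0 < n \<Longrightarrow> recursive n (\<lambda>xs. hd (tl xs))"
  by (rule recursive.cong[OF recursive.proj[of "Suc 0"]]) (auto simp: hd_conv_nth nth_tl
      simp flip: length_greater_0_conv)

lemma recursive_tl_nth: "Suc i < n \<Longrightarrow> recursive n (\<lambda>xs. tl xs ! i)"
  by (rule recursive.cong[OF recursive.proj[of "Suc i"]]) (auto simp: nth_tl)

lemma recursive_tl_tl_nth: "Suc (Suc i) < n \<Longrightarrow> recursive n (\<lambda>xs. tl (tl xs) ! i)"
  by (rule recursive.cong[OF recursive.proj[of "Suc (Suc i)"]]) (auto simp: nth_tl)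

lemma recursive_rec_nat:
  assumes "recursive n a"
    and "recursive (Suc (Suc n)) (\<lambda>ys. G (hd ys) (hd (tl ys)) (tl (tl ys)))"
    and "recursive n b"
  shows "recursive n (\<lambda>xs. rec_nat (a xs) (\<lambda>y r. G y r xs) (b xs))"
  using recursive_subst_hd[OF recursive.prec[OF assms(1,2)] assms(3)] by simp

lemmas recursive_basic = recursive_const recursive_Suc recursive.proj recursive_hd recursive_hd_tl
  recursive_tl_nth recursive_tl_tl_nth recursive_rec_nat

lemma recursive_add:
  assumes "recursive n a" "recursive n b"
  shows "recursive n (\<lambda>xs. a xs + b xs)"
proof -
  have eq: "x + y = rec_nat x (\<lambda>_ r. Suc r) y" for x y :: nat
    by (induction y) auto
  have "recursive 2 (\<lambda>xs. xs ! 0 + xs ! 1)"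
    unfolding eq by (intro recursive_basic) auto
  from recursive_comp2[OF this assms] show ?thesis .
qed

lemma recursive_diff:
  assumes "recursive n a" "recursive n b"
  shows "recursive n (\<lambda>xs. a xs - b xs)"
proof -
  have pred: "x - Suc 0 = rec_nat 0 (\<lambda>y _. y) x" for x :: nat
    by (cases x) auto
  have eq: "x - y = rec_nat x (\<lambda>_ r. rec_nat 0 (\<lambda>y _. y) r) y" for x y :: nat
    by (induction y) (auto simp flip: pred)
  have "recursive 2 (\<lambda>xs. xs ! 0 - xs ! 1)"
    unfolding eq by (intro recursive_basic) auto
  from recursive_comp2[OF this assms] show ?thesis .
qed

lemma recursive_if_zero:
  assumes "recursive n c" "recursive n a" "recursive n b"
  shows "recursive n (\<lambda>xs. if c xs = 0 then a xs else b xs)"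
proof -
  have eq: "(if x = 0 then y else z) = rec_nat y (\<lambda>_ _. z) x" for x y z :: nat
    by (cases x) auto
  have "recursive 3 (\<lambda>xs. if xs ! 0 = 0 then xs ! 1 else xs ! 2)"
    unfolding eq by (intro recursive_basic) auto
  note rec = this
  show ?thesis
    by (rule recursive_comp_list[of "[c, a, b]"
          "\<lambda>xs. if xs ! 0 = 0 then xs ! 1 else xs ! 2"])
      (use rec assms in \<open>auto simp: numeral_3_eq_3\<close>)
qed

section \<open>Decidable relations: comparison, connectives, bounded quantifiers\<close>

lemma recursive_if:
  assumes "recursive_rel n R" "recursive n a" "recursive n b"
  shows "recursive n (\<lambda>xs. if R xs then a xs else b xs)"
  by (rule recursive.cong[OF recursive_if_zero[OF assms(1)[unfolded recursive_rel_def] assms(3,2)]])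
    auto

lemma recursive_relI:
  "recursive n f \<Longrightarrow> (\<And>xs. length xs = n \<Longrightarrow> R xs \<longleftrightarrow> f xs = 0) \<Longrightarrow> recursive_rel n R"
  unfolding recursive_rel_def
  by (rule recursive.cong[OF recursive_if_zero[of n f, OF _ recursive_const recursive_const]]) auto

lemma recursive_rel_cong:
  "recursive_rel n R \<Longrightarrow> (\<And>xs. length xs = n \<Longrightarrow> R xs \<longleftrightarrow> S xs) \<Longrightarrow> recursive_rel n S"
  unfolding recursive_rel_def by (erule recursive.cong) simp

lemma recursive_rel_comp_list:
  assumes "recursive_rel (length gs) R" "\<forall>g\<in>set gs. recursive n g"
    and "\<And>xs. length xs = n \<Longrightarrow> R (map (\<lambda>g. g xs) gs) = S xs"
  shows "recursive_rel n S"
  unfolding recursive_rel_def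
  by (rule recursive_comp_list[OF assms(1)[unfolded recursive_rel_def] assms(2)])
    (simp add: assms(3))

lemma recursive_rel_eq:
  "recursive n a \<Longrightarrow> recursive n b \<Longrightarrow> recursive_rel n (\<lambda>xs. a xs = b xs)"
  by (rule recursive_relI[of n "\<lambda>xs. (a xs - b xs) + (b xs - a xs)"])
    (auto intro: recursive_add recursive_diff)

lemma recursive_rel_le:
  "recursive n a \<Longrightarrow> recursive n b \<Longrightarrow> recursive_rel n (\<lambda>xs. a xs \<le> b xs)"
  by (rule recursive_relI[of n "\<lambda>xs. a xs - b xs"]) (auto intro: recursive_diff)

lemma recursive_rel_less:
  "recursive n a \<Longrightarrow> recursive n b \<Longrightarrow> recursive_rel n (\<lambda>xs. a xs < b xs)"
  by (rule recursive_relI[of n "\<lambda>xs. Suc (a xs) - b xs"])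
    (auto intro: recursive_diff recursive_Suc)

lemma recursive_rel_not: "recursive_rel n R \<Longrightarrow> recursive_rel n (\<lambda>xs. \<not> R xs)"
  by (rule recursive_relI[of n "\<lambda>xs. if R xs then 1 else 0"]) (auto simp: recursive_rel_def)

lemma recursive_rel_conj:
  assumes "recursive_rel n R" "recursive_rel n S"
  shows "recursive_rel n (\<lambda>xs. R xs \<and> S xs)"
  by (rule recursive_relI[OF recursive_if[OF assms(1)
          recursive_if[OF assms(2) recursive_const[of n 0] recursive_const[of n 1]]
          recursive_const[of n 1]]]) auto

lemma recursive_rel_disj:
  assumes "recursive_rel n R" "recursive_rel n S"
  shows "recursive_rel n (\<lambda>xs. R xs \<or> S xs)"
  by (rule recursive_rel_cong[OF recursive_rel_not[OF
        recursive_rel_conj[OF assms[THEN recursive_rel_not]]]]) auto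

lemma recursive_rel_imp:
  assumes "recursive_rel n R" "recursive_rel n S"
  shows "recursive_rel n (\<lambda>xs. R xs \<longrightarrow> S xs)"
  by (rule recursive_rel_cong[OF recursive_rel_disj[OF recursive_rel_not[OF assms(1)] assms(2)]])
    auto

lemma recursive_rel_iff:
  assumes "recursive_rel n R" "recursive_rel n S"
  shows "recursive_rel n (\<lambda>xs. R xs \<longleftrightarrow> S xs)"
  by (rule recursive_rel_cong[OF recursive_rel_conj[OF
        recursive_rel_imp[OF assms] recursive_rel_imp[OF assms(2,1)]]]) auto

lemma recursive_rel_bex:
  assumes "recursive n b" "recursive_rel (Suc n) (\<lambda>ys. Q (hd ys) (tl ys))"
  shows "recursive_rel n (\<lambda>xs. \<exists>z<b xs. Q z xs)"
proof -
  have eq: "rec_nat 0 (\<lambda>z r. if Q z xs then 1 else r) k = (if \<exists>z<k. Q z xs then 1 else 0)"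
    for k xs by (induction k) (auto simp: less_Suc_eq)
  \<comment> \<open>The recursion step sees \<open>z # r # xs\<close>; the projections drop the
    accumulator \<open>r\<close>.\<close>
  have "recursive_rel (Suc (Suc n)) (\<lambda>ys. Q (hd ys) (tl (tl ys)))"
  proof (rule recursive_rel_comp_list
      [of "(\<lambda>ys. ys ! 0) # map (\<lambda>i ys. ys ! (i + 2)) [0..<n]" "\<lambda>ys. Q (hd ys) (tl ys)"])
    fix xs :: "nat list" assume len: "length xs = Suc (Suc n)"
    then have "map ((\<lambda>g. g xs) \<circ> (\<lambda>i ys. ys ! (i + 2))) [0..<n] = tl (tl xs)"
      by (intro nth_equalityI) (auto simp: nth_tl)
    then show "Q (hd (map (\<lambda>g. g xs) ((\<lambda>ys. ys ! 0) # map (\<lambda>i ys. ys ! (i + 2)) [0..<n])))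
         (tl (map (\<lambda>g. g xs) ((\<lambda>ys. ys ! 0) # map (\<lambda>i ys. ys ! (i + 2)) [0..<n])))
      = Q (hd xs) (tl (tl xs))"
      using len by (cases xs) auto
  qed (use assms(2) in \<open>auto intro: recursive.proj\<close>)
  from recursive_if[OF this recursive_const recursive_hd_tl] show ?thesis
    unfolding recursive_rel_def eq[symmetric]
    by (intro recursive_basic assms(1)) auto
qed

lemma recursive_rel_ball:
  assumes "recursive n b" "recursive_rel (Suc n) (\<lambda>ys. Q (hd ys) (tl ys))"
  shows "recursive_rel n (\<lambda>xs. \<forall>z<b xs. Q z xs)"
  by (rule recursive_rel_cong[OF recursive_rel_not[OF
        recursive_rel_bex[of n b "\<lambda>z xs. \<not> Q z xs", OF assms(1) recursive_rel_not[OF assms(2)]]]])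
    auto

lemma recursive_Least:
  assumes "recursive_rel (Suc n) (\<lambda>ys. Q (hd ys) (tl ys))"
    and "\<And>xs. length xs = n \<Longrightarrow> \<exists>y. Q y xs"
  shows "recursive n (\<lambda>xs. LEAST y. Q y xs)"
proof -
  \<comment> \<open>Minimisation looks for a zero, hence the value 0 exactly where \<open>Q\<close>
    holds.\<close>
  have "recursive (Suc n) (\<lambda>ys. if \<not> Q (hd ys) (tl ys) then 1 else 0)"
    using recursive_rel_not[OF assms(1)] by (simp only: recursive_rel_def)
  from recursive.cong[OF recursive.mu[OF this]] show ?thesis
    by (simp add: assms(2))
qed

lemmas recursive_intros = recursive_basic recursive_add recursive_diff recursive_if
  recursive_rel_eq recursive_rel_le recursive_rel_less recursive_rel_not recursive_rel_conj
  recursive_rel_disj recursive_rel_imp recursive_rel_iff recursive_rel_bex recursive_rel_ball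

section \<open>Pairing and canonical indices\<close>

lemma recursive_prod_encode:
  assumes "recursive n a" "recursive n b"
  shows "recursive n (\<lambda>xs. prod_encode (a xs, b xs))"
proof -
  have eq: "triangle k = rec_nat 0 (\<lambda>y r. r + Suc y) k" for k
    by (induction k) auto
  have "recursive 1 (\<lambda>xs. triangle (xs ! 0))"
    unfolding eq by (intro recursive_intros) auto
  from recursive_comp1[OF this recursive_add[OF assms]] show ?thesis
    by (simp add: prod_encode_def recursive_add assms(1))
qed

text \<open>Each component of a pair is at most its code, so the inner search is bounded and a
  single minimisation over a decidable relation remains.\<close>

lemma fst_prod_decode_Least:
  "fst (prod_decode w) = (LEAST a. \<exists>b<Suc w. prod_encode (a, b) = w)"
  by (rule Least_equality[symmetric])
    (auto intro!: exI[of _ "snd (prod_decode w)"] simp: less_Suc_eq_le,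
      metis le_prod_encode_2 prod.collapse prod_decode_inverse)

lemma snd_prod_decode_Least:
  "snd (prod_decode w) = (LEAST b. \<exists>a<Suc w. prod_encode (a, b) = w)"
  by (rule Least_equality[symmetric])
    (auto intro!: exI[of _ "fst (prod_decode w)"] simp: less_Suc_eq_le,
      metis le_prod_encode_1 prod.collapse prod_decode_inverse)

lemma recursive_fst_prod_decode:
  assumes "recursive n a"
  shows "recursive n (\<lambda>xs. fst (prod_decode (a xs)))"
proof (rule recursive_comp1[OF _ assms])
  show "recursive 1 (\<lambda>xs. fst (prod_decode (xs ! 0)))"
    unfolding fst_prod_decode_Least
  proof (rule recursive_Least)
    show "\<exists>y. \<exists>b<Suc (xs ! 0). prod_encode (y, b) = xs ! 0" for xs
      by (metis le_prod_encode_2 less_Suc_eq_le prod.collapse prod_decode_inverse)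
  qed (intro recursive_intros recursive_prod_encode; simp)
qed

lemma recursive_snd_prod_decode:
  assumes "recursive n a"
  shows "recursive n (\<lambda>xs. snd (prod_decode (a xs)))"
proof (rule recursive_comp1[OF _ assms])
  show "recursive 1 (\<lambda>xs. snd (prod_decode (xs ! 0)))"
    unfolding snd_prod_decode_Least
  proof (rule recursive_Least)
    show "\<exists>y. \<exists>a<Suc (xs ! 0). prod_encode (a, y) = xs ! 0" for xs
      by (metis le_prod_encode_1 less_Suc_eq_le prod.collapse prod_decode_inverse)
  qed (intro recursive_intros recursive_prod_encode; simp)
qed

section \<open>Membership and cardinality for canonical finite sets\<close>

lemma recursive_half:
  assumes "recursive n a"
  shows "recursive n (\<lambda>xs. a xs div 2)"
proof (rule recursive_comp1[OF _ assms])
  have eq: "k div 2 = (LEAST q. k < Suc (Suc (q + q)))" for k :: nat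
    by (rule Least_equality[symmetric]) auto
  show "recursive 1 (\<lambda>xs. xs ! 0 div 2)"
    unfolding eq
  proof (rule recursive_Least)
    show "\<exists>q. xs ! 0 < Suc (Suc (q + q))" for xs :: "nat list"
      by (rule exI[of _ "xs ! 0"]) auto
  qed (intro recursive_intros; simp)
qed

text \<open>Membership is bit \<open>z\<close> of \<open>u\<close>: the shift is iterated halving,
  and oddness is an equation in halves.\<close>

lemma recursive_rel_mem_D:
  assumes "recursive n z" "recursive n u"
  shows "recursive_rel n (\<lambda>xs. z xs \<in> D (u xs))"
proof -
  have div: "k div 2 ^ m = rec_nat k (\<lambda>_ r. r div 2) m" for k m :: nat
    by (induction m) (auto simp: div_mult2_eq power_Suc2 simp del: power_Suc)
  have odd: "odd k \<longleftrightarrow> k = Suc (k div 2 + k div 2)" for k :: nat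
    by presburger
  have mem: "m \<in> D k \<longleftrightarrow> k div 2 ^ m = Suc (k div 2 ^ m div 2 + k div 2 ^ m div 2)" for m k
    by (simp add: set_decode_def flip: odd)
  have "recursive 2 (\<lambda>xs. (xs ! 0) div 2 ^ (xs ! 1))"
    unfolding div by (intro recursive_intros recursive_half) auto
  from recursive_comp2[OF this assms(2,1)] show ?thesis
    unfolding mem by (intro recursive_intros recursive_half)
qed

lemma mem_D_less: "z \<in> D u \<Longrightarrow> z < u"
  by (metis div_less even_zero less_exp linorder_not_less mem_Collect_eq order_less_le_trans
      set_decode_def)

lemma recursive_card_D:
  assumes "recursive n u"
  shows "recursive n (\<lambda>xs. card (D (u xs)))"
proof (rule recursive_comp1[OF _ assms])
  have aux: "card {z\<in>D k. z < m} = rec_nat 0 (\<lambda>z r. if z \<in> D k then Suc r else r) m" for k m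
  proof (induction m)
    case (Suc m)
    have "{z\<in>D k. z < Suc m} = (if m \<in> D k then insert m {z\<in>D k. z < m} else {z\<in>D k. z < m})"
      by (auto simp: less_Suc_eq)
    then show ?case using Suc by simp
  qed simp
  \<comment> \<open>Elements of \<open>D k\<close> lie below \<open>k\<close>, so counting up to
    \<open>k\<close> catches them all.\<close>
  have eq: "card (D k) = rec_nat 0 (\<lambda>z r. if z \<in> D k then Suc r else r) k" for k
    unfolding aux[symmetric] by (rule arg_cong[of _ _ card]) (auto dest: mem_D_less)
  show "recursive 1 (\<lambda>xs. card (D (xs ! 0)))"
    unfolding eq by (intro recursive_intros recursive_rel_mem_D) auto
qed

lemmas recursive_code_intros = recursive_intros recursive_prod_encode recursive_fst_prod_decode
  recursive_snd_prod_decode recursive_rel_mem_D recursive_card_D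

lemma re_Collect_ex:
  assumes "recursive_rel 2 (\<lambda>xs. Q (xs ! 0) (xs ! 1))"
  shows "re {w. \<exists>c. Q w c}"
proof (cases "{w. \<exists>c. Q w c} = {}")
  case False
  then obtain w0 c0 where w0: "Q w0 c0" by auto
  \<comment> \<open>Pairs that fail \<open>Q\<close> are sent to the known element
    \<open>w0\<close>, which keeps \<open>?f\<close> total without enlarging the set.\<close>
  let ?f = "\<lambda>k. if Q (fst (prod_decode k)) (snd (prod_decode k)) then fst (prod_decode k) else w0"
  have "recursive_rel 1 (\<lambda>xs. Q (fst (prod_decode (xs ! 0))) (snd (prod_decode (xs ! 0))))"
    by (rule recursive_rel_comp_list[of "[\<lambda>xs. fst (prod_decode (xs ! 0)),
            \<lambda>xs. snd (prod_decode (xs ! 0))]" "\<lambda>xs. Q (xs ! 0) (xs ! 1)"])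
      (use assms in \<open>auto simp: numeral_2_eq_2 intro!: recursive_code_intros\<close>)
  then have "recursive_fun ?f"
    unfolding recursive_fun_def by (intro recursive_code_intros) auto
  moreover have "{w. \<exists>c. Q w c} = range ?f"
  proof (intro equalityI subsetI)
    fix w assume "w \<in> {w. \<exists>c. Q w c}"
    then obtain c where "Q w c" by auto
    then have "w = ?f (prod_encode (w, c))" by simp
    then show "w \<in> range ?f" by blast
  qed (use w0 in \<open>auto split: if_splits\<close>)
  ultimately show ?thesis unfolding re_def by blast
qed (simp add: re_def)

section \<open>Membership in the arithmetical class\<close>

text \<open>An increasing sequence never loses a point, so each point of \<open>F\<close> has its
  final status from some stage on; finitely many such stages have a maximum.\<close>

lemma finite_inter_stabilises:
  fixes A :: "nat \<Rightarrow> 'a set"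
  assumes "mono A" "finite F"
  shows "\<exists>s0. \<forall>t\<ge>s0. A t \<inter> F = (\<Union>s. A s) \<inter> F"
  using assms(2)
proof (induction F)
  case (insert z F)
  then obtain s0 where s0: "\<And>t. t \<ge> s0 \<Longrightarrow> A t \<inter> F = (\<Union>s. A s) \<inter> F" by blast
  obtain s1 where s1: "\<And>t. t \<ge> s1 \<Longrightarrow> z \<in> A t \<longleftrightarrow> z \<in> (\<Union>s. A s)"
    by (metis UN_iff UNIV_I assms(1) monoD subsetD)
  have "A t \<inter> insert z F = (\<Union>s. A s) \<inter> insert z F" if "t \<ge> max s0 s1" for t
    using s0[of t] s1[of t] that by fastforce
  then show ?case by blast
qed simp

text \<open>The condition "if \<open>A\<close> and \<open>B\<close> agree on \<open>F\<close>, then they are equal" is a disjunction of a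
  \<open>\<Delta>\<^sup>0\<^sub>2\<close> and a \<open>\<Pi>\<^sup>0\<^sub>2\<close> condition; in terms of stages one \<open>\<forall>\<exists>\<close> prefix serves both.\<close>

lemma agree_imp_eq_iff_stages:
  fixes A B :: "nat \<Rightarrow> nat set"
  assumes "mono A" "mono B" "finite F"
  shows "((\<Union>s. A s) \<noteq> (\<Union>s. B s) \<longrightarrow> (\<Union>s. A s) \<inter> F \<noteq> (\<Union>s. B s) \<inter> F) \<longleftrightarrow>
    (\<forall>s. \<exists>t\<ge>s. A t \<inter> F \<noteq> B t \<inter> F \<or> (\<forall>z<s. (z \<in> A s \<longrightarrow> z \<in> B t) \<and> (z \<in> B s \<longrightarrow> z \<in> A t)))"
    (is "?L \<longleftrightarrow> (\<forall>s. \<exists>t\<ge>s. ?P s t)")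
proof -
  obtain sA where sA: "\<forall>t\<ge>sA. A t \<inter> F = (\<Union>s. A s) \<inter> F"
    using finite_inter_stabilises[OF assms(1,3)] ..
  obtain sB where sB: "\<forall>t\<ge>sB. B t \<inter> F = (\<Union>s. B s) \<inter> F"
    using finite_inter_stabilises[OF assms(2,3)] ..
  \<comment> \<open>From \<open>s0\<close> on both approximations are final on \<open>F\<close>, so
    a difference of the limits on \<open>F\<close> shows at every such stage.\<close>
  define s0 where "s0 = max sA sB"
  have s0: "A t \<inter> F = (\<Union>s. A s) \<inter> F" "B t \<inter> F = (\<Union>s. B s) \<inter> F" if "t \<ge> s0" for t
    using that sA sB by (auto simp: s0_def)
  show ?thesis
  proof
    assume ?L
    show "\<forall>s. \<exists>t\<ge>s. ?P s t"
    proof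
      fix s
      show "\<exists>t\<ge>s. ?P s t"
      proof (cases "(\<Union>s. A s) = (\<Union>s. B s)")
        case True
        obtain tA where tA: "\<forall>t\<ge>tA. A t \<inter> {..<s} = (\<Union>s. A s) \<inter> {..<s}"
          using finite_inter_stabilises[OF assms(1), of "{..<s}"] by auto
        obtain tB where tB: "\<forall>t\<ge>tB. B t \<inter> {..<s} = (\<Union>s. B s) \<inter> {..<s}"
          using finite_inter_stabilises[OF assms(2), of "{..<s}"] by auto
        \<comment> \<open>For equal limits, by stage \<open>t\<close> each side contains every
          member of the common limit below \<open>s\<close>, hence whatever the other side has there
          at stage \<open>s\<close>.\<close>
        define t where "t = max s (max tA tB)"
        have "A t \<inter> {..<s} = (\<Union>s. A s) \<inter> {..<s}"
          using tA by (simp add: t_def)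
        then have At: "z \<in> A t" if "z \<in> (\<Union>s. A s)" "z < s" for z
          by (metis Int_iff lessThan_iff that)
        have "B t \<inter> {..<s} = (\<Union>s. B s) \<inter> {..<s}"
          using tB by (simp add: t_def)
        then have Bt: "z \<in> B t" if "z \<in> (\<Union>s. B s)" "z < s" for z
          by (metis Int_iff lessThan_iff that)
        have "?P s t"
        proof (intro disjI2 allI impI conjI)
          fix z assume "z < s"
          show "z \<in> B t" if "z \<in> A s"
            using \<open>z < s\<close> that by (intro Bt) (auto simp flip: True)
          show "z \<in> A t" if "z \<in> B s"
            using \<open>z < s\<close> that by (intro At) (auto simp: True)
        qed
        then show ?thesis by (intro exI[of _ t]) (simp add: t_def)
      next
        case False
        with \<open>?L\<close> have "A (max s s0) \<inter> F \<noteq> B (max s s0) \<inter> F"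
          using s0 by simp
        then show ?thesis by (intro exI[of _ "max s s0"]) simp
      qed
    qed
  next
    assume R: "\<forall>s. \<exists>t\<ge>s. ?P s t"
    show ?L
    proof (rule impI, rule notI)
      assume eqF: "(\<Union>s. A s) \<inter> F = (\<Union>s. B s) \<inter> F" and ne: "(\<Union>s. A s) \<noteq> (\<Union>s. B s)"
      \<comment> \<open>Agreement on \<open>F\<close> excludes the first disjunct past
        \<open>s0\<close>, which leaves the mutual inclusion.\<close>
      have key: "\<exists>t. \<forall>z<s. (z \<in> A s \<longrightarrow> z \<in> B t) \<and> (z \<in> B s \<longrightarrow> z \<in> A t)" if "s \<ge> s0" for s
      proof -
        obtain t where "t \<ge> s" "?P s t" using R by blast
        moreover have "A t \<inter> F = B t \<inter> F" using s0[of t] eqF \<open>t \<ge> s\<close> that by simp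
        ultimately show ?thesis by blast
      qed
      have "z \<in> (\<Union>s. A s) \<longleftrightarrow> z \<in> (\<Union>s. B s)" for z
      proof -
        have stage: "\<exists>r\<ge>s. \<exists>t. (z \<in> A r \<longrightarrow> z \<in> B t) \<and> (z \<in> B r \<longrightarrow> z \<in> A t)" for s
        proof -
          \<comment> \<open>Past \<open>s0\<close> to apply \<open>key\<close>, past
            \<open>s\<close> so that monotonicity carries \<open>z\<close> along, and past
            \<open>z\<close> so that the bound covers it.\<close>
          define r where "r = max s0 (max s (Suc z))"
          have "s0 \<le> r" "s \<le> r" "z < r" by (simp_all add: r_def)
          with key[of r] show ?thesis by blast
        qed
        have "z \<in> (\<Union>s. B s)" if "z \<in> A s" for s
          using stage[of s] monoD[OF assms(1)] that by blast
        moreover have "z \<in> (\<Union>s. A s)" if "z \<in> B s" for s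
          using stage[of s] monoD[OF assms(2)] that by blast
        ultimately show ?thesis by blast
      qed
      with ne show False by blast
    qed
  qed
qed

text \<open>If \<open>h\<close> enumerates the codes \<open>prod_encode (e, k)\<close> with
  \<open>k\<close> in \<open>W e\<close>, this is the part of \<open>L W e j\<close> found in the
  first \<open>s\<close> steps.\<close>

definition L_stage :: "(nat \<Rightarrow> nat) \<Rightarrow> nat \<Rightarrow> nat \<Rightarrow> nat \<Rightarrow> nat set" where
  "L_stage h e j s = {z. \<exists>i<s. h i = prod_encode (e, prod_encode (j, z))}"

lemma mono_L_stage: "mono (L_stage h e j)"
  by (rule monoI) (force simp: L_stage_def)

lemma recursive_rel_mem_L_stage:
  assumes "recursive_fun h" "recursive n e" "recursive n j" "recursive n s" "recursive n z"
  shows "recursive_rel n (\<lambda>xs. z xs \<in> L_stage h (e xs) (j xs) (s xs))"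
proof -
  have "recursive_rel 4 (\<lambda>xs. xs ! 3 \<in> L_stage h (xs ! 0) (xs ! 1) (xs ! 2))"
    unfolding L_stage_def mem_Collect_eq
    by (intro recursive_code_intros recursive_comp1[OF assms(1)[unfolded recursive_fun_def]]) auto
  note rec = this
  show ?thesis
    by (rule recursive_rel_comp_list[of "[e, j, s, z]"
          "\<lambda>xs. xs ! 3 \<in> L_stage h (xs ! 0) (xs ! 1) (xs ! 2)"])
      (use rec assms(2-) in \<open>auto simp: numeral_eq_Suc\<close>)
qed

text \<open>The matrix of \<open>agree_imp_eq_iff_stages\<close> for \<open>F = D u\<close>. A
  canonical index exceeds all elements of its set, so the bound \<open>z<u\<close> loses nothing and
  keeps the matrix decidable.\<close>

definition DS_stage :: "(nat \<Rightarrow> nat) \<Rightarrow> nat \<Rightarrow> nat \<Rightarrow> nat \<Rightarrow> nat \<Rightarrow> nat \<Rightarrow> nat \<Rightarrow> bool" where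
  "DS_stage h e x u y s t \<longleftrightarrow>
    (\<exists>z<u. z \<in> D u \<and> \<not> (z \<in> L_stage h e x t \<longleftrightarrow> z \<in> L_stage h e y t)) \<or>
    (\<forall>z<s. (z \<in> L_stage h e x s \<longrightarrow> z \<in> L_stage h e y t) \<and>
           (z \<in> L_stage h e y s \<longrightarrow> z \<in> L_stage h e x t))"

lemma recursive_rel_DS_stage:
  assumes "recursive_fun h" "recursive n e" "recursive n x" "recursive n u"
    "recursive n y" "recursive n s" "recursive n t"
  shows "recursive_rel n (\<lambda>xs. DS_stage h (e xs) (x xs) (u xs) (y xs) (s xs) (t xs))"
proof -
  have "recursive_rel 6 (\<lambda>xs. DS_stage h (xs ! 0) (xs ! 1) (xs ! 2) (xs ! 3) (xs ! 4) (xs ! 5))"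
    unfolding DS_stage_def
    by (intro recursive_code_intros recursive_rel_mem_L_stage[OF assms(1)]) auto
  note rec = this
  show ?thesis
    by (rule recursive_rel_comp_list[of "[e, x, u, y, s, t]"
          "\<lambda>xs. DS_stage h (xs ! 0) (xs ! 1) (xs ! 2) (xs ! 3) (xs ! 4) (xs ! 5)"])
      (use rec assms(2-) in \<open>auto simp: numeral_eq_Suc\<close>)
qed

lemma triple_eq_iff: "triple e x u = triple e' x' u' \<longleftrightarrow> e = e' \<and> x = x' \<and> u = u'"
  by (auto simp: triple_def prod_encode_eq)

lemma triple_mem_DS:
  "triple e x u \<in> DS W \<longleftrightarrow> (\<forall>y. L W e x \<noteq> L W e y \<longrightarrow> L W e x \<inter> D u \<noteq> L W e y \<inter> D u)"
  unfolding DS_def mem_Collect_eq triple_eq_iff by blast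

lemma triple_mem_MDS:
  "triple e x u \<in> MDS W \<longleftrightarrow> triple e x u \<in> DS W \<and>
     (\<forall>u'. card (D u') < card (D u) \<longrightarrow> triple e x u' \<notin> DS W)"
  unfolding MDS_def mem_Collect_eq triple_eq_iff by blast

lemma triple_mem_DS_stages:
  assumes "\<And>e j. L W e j = (\<Union>s. L_stage h e j s)"
  shows "triple e x u \<in> DS W \<longleftrightarrow> (\<forall>y s. \<exists>t\<ge>s. DS_stage h e x u y s t)"
proof -
  have "DS_stage h e x u y s t \<longleftrightarrow> L_stage h e x t \<inter> D u \<noteq> L_stage h e y t \<inter> D u \<or>
    (\<forall>z<s. (z \<in> L_stage h e x s \<longrightarrow> z \<in> L_stage h e y t) \<and>
           (z \<in> L_stage h e y s \<longrightarrow> z \<in> L_stage h e x t))" for y s t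
    unfolding DS_stage_def using mem_D_less[of _ u] by blast
  then show ?thesis
    unfolding triple_mem_DS assms
      agree_imp_eq_iff_stages[OF mono_L_stage mono_L_stage finite_set_decode] by presburger
qed

lemma acceptable_numbering_stages:
  assumes "acceptable_numbering W"
  obtains h where "recursive_fun h" "\<And>e j. L W e j = (\<Union>s. L_stage h e j s)"
proof -
  \<comment> \<open>An index of \<open>UNIV\<close> shows that the coded graph of \<open>W\<close>
    is nonempty, so \<open>re\<close> supplies an enumerating function.\<close>
  have "recursive_fun (\<lambda>x. x)"
    unfolding recursive_fun_def by (intro recursive.proj) simp
  then have "re UNIV" unfolding re_def by (metis image_ident)
  then obtain e0 where "W e0 = UNIV"
    using assms unfolding acceptable_numbering_def by (metis (mono_tags) mem_Collect_eq rangeE)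
  then have "{prod_encode (e, x) | e x. x \<in> W e} \<noteq> {}" by auto
  moreover have "re {prod_encode (e, x) | e x. x \<in> W e}"
    using assms by (simp only: acceptable_numbering_def uniformly_re_def)
  ultimately obtain h where h: "recursive_fun h" "{prod_encode (e, x) | e x. x \<in> W e} = range h"
    by (auto simp only: re_def)
  have "x \<in> W e \<longleftrightarrow> (\<exists>i. h i = prod_encode (e, x))" for x e
  proof -
    have "x \<in> W e \<longleftrightarrow> prod_encode (e, x) \<in> {prod_encode (e, x) | e x. x \<in> W e}"
      by (auto simp: prod_encode_eq)
    also have "\<dots> \<longleftrightarrow> (\<exists>i. h i = prod_encode (e, x))"
      unfolding h(2) by (metis rangeE rangeI)
    finally show ?thesis .
  qed
  then have "L W e j = (\<Union>s. L_stage h e j s)" for e j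
    by (auto simp: L_def L_stage_def)
  with h(1) show ?thesis by (rule that)
qed

section \<open>Three-quantifier form of \<open>MDS\<close>\<close>

lemma pi_formula_3: "pi_formula 3 R [x] \<longleftrightarrow> (\<forall>a. \<exists>b. \<forall>c. R [x, a, b, c])"
  by (simp add: numeral_3_eq_3)

lemma pi_set_MDS:
  assumes "acceptable_numbering W"
  shows "pi_set 3 (MDS W)"
proof -
  obtain h where h: "recursive_fun h" "\<And>e j. L W e j = (\<Union>s. L_stage h e j s)"
    using acceptable_numbering_stages[OF assms] by blast
  note DS = triple_mem_DS_stages[OF h(2)]
  let ?fst = "\<lambda>k. fst (prod_decode k)" and ?snd = "\<lambda>k. snd (prod_decode k)"
  \<comment> \<open>The variables: \<open>a = \<langle>u', \<langle>y, s\<rangle>\<rangle>\<close>, \<open>b = \<langle>t, \<langle>y', s'\<rangle>\<rangle>\<close> and \<open>c = t'\<close>, where the primed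
    ones serve the minimality condition.\<close>
  define R where "R xs \<longleftrightarrow> (let w = xs ! 0; a = xs ! 1; b = xs ! 2; c = xs ! 3;
      e = ?fst w; x = ?fst (?snd w); u = ?snd (?snd w) in
      (?snd (?snd a) \<le> ?fst b \<and> DS_stage h e x u (?fst (?snd a)) (?snd (?snd a)) (?fst b)) \<and>
      (card (D (?fst a)) < card (D u) \<longrightarrow> ?snd (?snd b) \<le> c \<longrightarrow>
        \<not> DS_stage h e x (?fst a) (?fst (?snd b)) (?snd (?snd b)) c))" for xs
  have "recursive_rel 4 R"
    unfolding R_def Let_def
    by (intro recursive_code_intros recursive_rel_DS_stage[OF h(1)]) auto
  moreover have "MDS W = {w. pi_formula 3 R [w]}"
  proof (intro equalityI subsetI; clarsimp simp: pi_formula_3)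
    fix w a assume "w \<in> MDS W"
    moreover obtain e x u where w: "w = triple e x u"
      unfolding triple_def by (metis prod.collapse prod_decode_inverse)
    ultimately have "triple e x u \<in> DS W"
      "\<And>u'. card (D u') < card (D u) \<Longrightarrow> triple e x u' \<notin> DS W"
      using triple_mem_MDS by blast+
    then obtain t y' s' where "t \<ge> ?snd (?snd a)"
      "DS_stage h e x u (?fst (?snd a)) (?snd (?snd a)) t"
      "card (D (?fst a)) < card (D u) \<longrightarrow> (\<forall>t'\<ge>s'. \<not> DS_stage h e x (?fst a) y' s' t')"
      unfolding DS by meson
    then show "\<exists>b. \<forall>c. R [w, a, b, c]"
      by (intro exI[of _ "prod_encode (t, prod_encode (y', s'))"])
        (simp add: R_def w triple_def)
  next
    fix w assume R: "\<forall>a. \<exists>b. \<forall>c. R [w, a, b, c]"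
    obtain e x u where w: "w = triple e x u"
      unfolding triple_def by (metis prod.collapse prod_decode_inverse)
    have "\<exists>t\<ge>s. DS_stage h e x u y s t" for y s
      \<comment> \<open>Only one conjunct of \<open>R\<close> is wanted at a time, so the other
        slots of \<open>a\<close> receive 0: here \<open>u'\<close>, below \<open>y\<close> and
        \<open>s\<close>.\<close>
      using R[rule_format, of "prod_encode (0, prod_encode (y, s))"]
      by (auto simp: R_def w triple_def)
    moreover have "\<exists>y s. \<forall>t\<ge>s. \<not> DS_stage h e x u' y s t" if "card (D u') < card (D u)" for u'
      using R[rule_format, of "prod_encode (u', 0)"] that
      by (auto simp: R_def w triple_def)
    ultimately show "w \<in> MDS W"
      unfolding w triple_mem_MDS DS by blast
  qed
  ultimately show ?thesis
    unfolding pi_set_def by (intro exI[of _ R]) (simp add: numeral_eq_Suc)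
qed

section \<open>Hardness\<close>

text \<open>The index \<open>j = \<langle>0, b\<rangle>\<close> yields the empty set, \<open>\<langle>1, b\<rangle>\<close> and \<open>\<langle>2, b\<rangle>\<close> the complements of
  \<open>{0}\<close> and \<open>{1}\<close>, and \<open>\<langle>v + 3, b\<rangle>\<close> the set that may lack \<open>v + 2\<close>.\<close>

definition hard_matrix :: "(nat list \<Rightarrow> bool) \<Rightarrow> nat \<Rightarrow> nat \<Rightarrow> nat \<Rightarrow> nat \<Rightarrow> bool" where
  "hard_matrix R p j z c \<longleftrightarrow> fst (prod_decode j) \<noteq> 0 \<and>
     (Suc z \<noteq> fst (prod_decode j) \<or> 2 \<le> z \<and> \<not> R [p, z - 2, snd (prod_decode j), c])"

definition hard_family :: "(nat list \<Rightarrow> bool) \<Rightarrow> nat \<Rightarrow> nat set" where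
  "hard_family R p = {prod_encode (j, z) | j z. \<exists>c. hard_matrix R p j z c}"

lemma mem_hard_family:
  "prod_encode (j, z) \<in> hard_family R p \<longleftrightarrow> (\<exists>c. hard_matrix R p j z c)"
  by (auto simp: hard_family_def prod_encode_eq)

text \<open>The coded graph is the projection along \<open>c\<close> of a decidable
  relation.\<close>

lemma uniformly_re_hard_family:
  assumes "recursive_rel 4 R"
  shows "uniformly_re (hard_family R)"
proof -
  let ?fst = "\<lambda>k. fst (prod_decode k)" and ?snd = "\<lambda>k. snd (prod_decode k)"
  let ?Q = "\<lambda>w c. hard_matrix R (?fst w) (?fst (?snd w)) (?snd (?snd w)) c"
  have "{prod_encode (p, k) | p k. k \<in> hard_family R p} = {w. \<exists>c. ?Q w c}"
  proof (rule set_eqI)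
    fix w
    obtain p j z where w: "w = prod_encode (p, prod_encode (j, z))"
      by (metis prod.collapse prod_decode_inverse)
    show "w \<in> {prod_encode (p, k) | p k. k \<in> hard_family R p} \<longleftrightarrow> w \<in> {w. \<exists>c. ?Q w c}"
      by (auto simp: w prod_encode_eq mem_hard_family)
  qed
  moreover have "recursive_rel 2 (\<lambda>xs. ?Q (xs ! 0) (xs ! 1))"
  proof -
    have R: "recursive_rel n (\<lambda>xs. R [a xs, b xs, c xs, d xs])"
      if "recursive n a" "recursive n b" "recursive n c" "recursive n d" for n a b c d
      by (rule recursive_rel_comp_list[of "[a, b, c, d]" R])
        (use assms that in \<open>auto simp: numeral_eq_Suc\<close>)
    show ?thesis
      unfolding hard_matrix_def by (intro recursive_code_intros R) auto
  qed
  ultimately show ?thesis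
    unfolding uniformly_re_def using re_Collect_ex[of ?Q] by simp
qed

text \<open>Index 0 codes \<open>(0, 0)\<close> and so names the empty set; 3 is the canonical index
  of \<open>{0, 1}\<close>. Relative to the empty set, \<open>DS\<close> says that
  \<open>D u\<close> meets every nonempty member of the family.\<close>

lemma triple_mem_MDS_hard_family:
  assumes "W e = hard_family R p"
  shows "triple e 0 3 \<in> MDS W \<longleftrightarrow> (\<forall>v. \<exists>b. \<forall>c. R [p, v, b, c])"
proof -
  have L: "z \<in> L W e j \<longleftrightarrow> (\<exists>c. hard_matrix R p j z c)" for z j
    by (simp add: L_def assms mem_hard_family)
  have L0: "L W e (prod_encode (0, b)) = {}" for b
    by (auto simp: L hard_matrix_def)
  have L_Suc: "z \<in> L W e (prod_encode (Suc i, b)) \<longleftrightarrow>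
      z \<noteq> i \<or> 2 \<le> z \<and> (\<exists>c. \<not> R [p, z - 2, b, c])" for z i b
    by (auto simp: L hard_matrix_def)
  have "prod_encode (0, 0) = 0" by (simp add: prod_encode_def)
  then have L_0: "L W e 0 = {}" using L0[of 0] by simp
  have D3: "D 3 = {0, 1}"
    using D_canonical[of "{0, 1}"] by (simp add: numeral_3_eq_3)
  have DS: "triple e 0 u \<in> DS W \<longleftrightarrow> (\<forall>i b. \<exists>z\<in>D u. z \<in> L W e (prod_encode (Suc i, b)))" for u
  proof -
    have "triple e 0 u \<in> DS W \<longleftrightarrow> (\<forall>j. L W e j \<noteq> {} \<longrightarrow> L W e j \<inter> D u \<noteq> {})"
      unfolding triple_mem_DS L_0 by auto
    also have "\<dots> \<longleftrightarrow> (\<forall>i b. L W e (prod_encode (i, b)) \<noteq> {} \<longrightarrow>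
        L W e (prod_encode (i, b)) \<inter> D u \<noteq> {})"
      by (metis prod.collapse prod_decode_inverse)
    also have "\<dots> \<longleftrightarrow> (\<forall>i b. L W e (prod_encode (Suc i, b)) \<inter> D u \<noteq> {})"
    proof -
      \<comment> \<open>Only \<open>i\<close> can be missing here, so \<open>Suc i\<close> witnesses
        nonemptiness.\<close>
      have "Suc i \<in> L W e (prod_encode (Suc i, b))" for i b
        by (simp add: L_Suc)
      then have "L W e (prod_encode (Suc i, b)) \<noteq> {}" for i b by blast
      then show ?thesis by (metis L0 not0_implies_Suc)
    qed
    finally show ?thesis by blast
  qed
  \<comment> \<open>A nonempty member lacks at most one number, so it contains 0 or 1.\<close>
  have "triple e 0 3 \<in> DS W"
    unfolding DS D3 by (auto simp: L_Suc)
  moreover have "triple e 0 u \<notin> DS W" if "D u = {}" for u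
    unfolding DS by (simp add: that)
  \<comment> \<open>Among the nonempty members only those with first index \<open>Suc k\<close> can
    miss \<open>k\<close>: always if \<open>k < 2\<close>, otherwise iff \<open>R\<close> holds for
    all \<open>c\<close>.\<close>
  moreover have "triple e 0 u \<notin> DS W \<longleftrightarrow> k < 2 \<or> (\<exists>b. \<forall>c. R [p, k - 2, b, c])"
    if "D u = {k}" for u k
    unfolding DS that by (auto simp: L_Suc)
  moreover have "card (D u) < card (D 3) \<longleftrightarrow> D u = {} \<or> (\<exists>k. D u = {k})" for u
    unfolding D3 by (auto simp: less_2_cases_iff card_1_singleton_iff numeral_2_eq_2 less_Suc_eq)
  ultimately have "triple e 0 3 \<in> MDS W \<longleftrightarrow>
      (\<forall>u k. D u = {k} \<longrightarrow> k < 2 \<or> (\<exists>b. \<forall>c. R [p, k - 2, b, c]))"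
    unfolding triple_mem_MDS by metis
  \<comment> \<open>Every singleton has a canonical index, so \<open>k\<close> ranges over all
    numbers; then \<open>k = v + 2\<close>.\<close>
  also have "\<dots> \<longleftrightarrow> (\<forall>k. k < 2 \<or> (\<exists>b. \<forall>c. R [p, k - 2, b, c]))"
    by (metis set_encode_inverse finite.emptyI finite.insertI)
  also have "\<dots> \<longleftrightarrow> (\<forall>v. \<exists>b. \<forall>c. R [p, v, b, c])"
    by (metis add_diff_cancel_right' not_add_less2)
  finally show ?thesis .
qed

theorem theorem2:
  fixes W :: "nat \<Rightarrow> nat set"
  assumes "acceptable_numbering W"
  shows "pi_complete 3 (MDS W)"
  unfolding pi_complete_def
proof (intro conjI allI impI)
  show "pi_set 3 (MDS W)" using assms by (rule pi_set_MDS)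
next
  fix B assume "pi_set 3 B"
  then obtain R where R: "recursive_rel 4 R" and B: "B = {x. pi_formula 3 R [x]}"
    unfolding pi_set_def by (auto simp: numeral_eq_Suc)
  \<comment> \<open>Acceptability translates the uniformly r.e. family into \<open>W\<close>, with
    indices recursive in \<open>p\<close>.\<close>
  obtain g where g: "recursive_fun g" "\<And>p. W (g p) = hard_family R p"
    using assms uniformly_re_hard_family[OF R] unfolding acceptable_numbering_def by metis
  have "recursive_fun (\<lambda>p. triple (g p) 0 3)"
    unfolding recursive_fun_def triple_def
    by (intro recursive_code_intros g(1)[unfolded recursive_fun_def])
  moreover have "p \<in> B \<longleftrightarrow> triple (g p) 0 3 \<in> MDS W" for p
    unfolding B mem_Collect_eq pi_formula_3 triple_mem_MDS_hard_family[of W, OF g(2)] ..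
  ultimately show "many_one_reducible B (MDS W)"
    unfolding many_one_reducible_def by (intro exI[of _ "\<lambda>p. triple (g p) 0 3"]) simp
qed

end
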